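(* Let $\lambda>0$ and let $H:T^*\mathbb{T}^n\to\mathbb{R}$ be a $C^r$ ($r\geq 2$) Tonelli Hamiltonian. Let $P\in C^1(\mathbb{T}^n,\mathbb{R}^n)$ be such that $\Sigma=\{(x,P(x)) : x\in\mathbb{T}^n\}$ is a $C^1$ Lagrangian graph in $T^*\mathbb{T}^n$, and write $P(x)=d_xu(x)+c$ with $u\in C^2(\mathbb{T}^n,\mathbb{R})$ and $c\in\mathbb{R}^n\cong H^1(\mathbb{T}^n,\mathbb{R})$. If $\Sigma$ is $\Phi^t_{H,\lambda}$-invariant for all $t\in\mathbb{R}$, then $c=0$. In other words, any $\Phi_{H,\lambda}^t$-invariant Lagrangian graph $\Sigma$ is exact.
   Context: $\mathbb{T}^n=\mathbb{R}^n/\mathbb{Z}^n$ and $T^*\mathbb{T}^n=\mathbb{T}^n\times\mathbb{R}^n$ with coordinates $(x,p)$. A Hamiltonian $H$ is Tonelli if (i) $H_{pp}(x,p)$ is positive definite for every $(x,p)$, and (ii) $\lim_{|p|\to+\infty}H(x,p)/|p|=+\infty$ for every $x$. $\Phi^t_{H,\lambda}$ denotes the (local) flow of the conformally symplectic system $$\dot x=H_p(x,p),\qquad \dot p=-H_x(x,p)-\lambda p .$$ A $C^1$ graph $\Sigma=\{(x,P(x))\}$ is Lagrangian if the symplectic form $dp\wedge dx=\sum_i dp_i\wedge dx_i$ vanishes on $T\Sigma$; in that case $P=d_xu+c$ for some $u\in C^2(\mathbb{T}^n,\mathbb{R})$ and a unique constant vector $c\in\mathbb{R}^n$. $\Sigma$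 is exact if $c=0$. *)

theory Defs
  imports "HOL-Analysis.Analysis"
begin

text \<open>
  Functions on the torus \<open>\<real>\<^sup>n / \<int>\<^sup>n\<close> are represented by their \<open>\<int>\<^sup>n\<close>-periodic lifts to
  \<^typ>\<open>real ^ 'n\<close>, and functions on its cotangent bundle by functions of pairs \<open>(x, p)\<close> that are
  periodic in \<open>x\<close>. Subsets of the cotangent bundle are represented by their full preimages in
  \<^typ>\<open>(real ^ 'n) \<times> (real ^ 'n)\<close>, and the flow by its lift.
\<close>

definition int_vec :: "real ^ 'n \<Rightarrow> bool" where
  "int_vec k \<longleftrightarrow> (\<forall>i. k $ i \<in> \<int>)"

definition torus_fun :: "(real ^ 'n \<Rightarrow> 'b) \<Rightarrow> bool" where
  "torus_fun f \<longleftrightarrow> (\<forall>x k. int_vec k \<longrightarrow> f (x + k) = f x)"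

definition cotangent_fun :: "((real ^ 'n) \<times> (real ^ 'n) \<Rightarrow> 'b) \<Rightarrow> bool" where
  "cotangent_fun H \<longleftrightarrow> (\<forall>p. torus_fun (\<lambda>x. H (x, p)))"

text \<open>
  \<open>C_k k f\<close>: \<open>f\<close> is of class \<open>C\<^sup>k\<close> on the whole space. In finite dimension, continuity of all
  iterated directional derivatives is the same as continuity of the iterated Frechet derivatives.
\<close>

primrec C_k ::
  "nat \<Rightarrow> ('a::euclidean_space \<Rightarrow> 'b::euclidean_space) \<Rightarrow> bool" where
  "C_k 0 f \<longleftrightarrow> continuous_on UNIV f"
| "C_k (Suc k) f \<longleftrightarrow>
     (\<forall>x. f differentiable (at x)) \<and> (\<forall>v. C_k k (\<lambda>x. frechet_derivative f (at x) v))"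

definition grad :: "(real ^ 'n \<Rightarrow> real) \<Rightarrow> real ^ 'n \<Rightarrow> real ^ 'n" where
  "grad f x = (\<chi> i. frechet_derivative f (at x) (axis i 1))"

definition H_x :: "((real ^ 'n) \<times> (real ^ 'n) \<Rightarrow> real) \<Rightarrow> (real ^ 'n) \<times> (real ^ 'n) \<Rightarrow> real ^ 'n" where
  "H_x H z = grad (\<lambda>y. H (y, snd z)) (fst z)"

definition H_p :: "((real ^ 'n) \<times> (real ^ 'n) \<Rightarrow> real) \<Rightarrow> (real ^ 'n) \<times> (real ^ 'n) \<Rightarrow> real ^ 'n" where
  "H_p H z = grad (\<lambda>q. H (fst z, q)) (snd z)"

text \<open>The second derivative \<open>H\<^sub>p\<^sub>p\<close>, as a linear map.\<close>

definition H_pp ::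
  "((real ^ 'n) \<times> (real ^ 'n) \<Rightarrow> real) \<Rightarrow> (real ^ 'n) \<times> (real ^ 'n) \<Rightarrow> real ^ 'n \<Rightarrow> real ^ 'n" where
  "H_pp H z = frechet_derivative (\<lambda>q. H_p H (fst z, q)) (at (snd z))"

definition tonelli :: "((real ^ 'n) \<times> (real ^ 'n) \<Rightarrow> real) \<Rightarrow> bool" where
  "tonelli H \<longleftrightarrow>
     (\<forall>z v. v \<noteq> 0 \<longrightarrow> H_pp H z v \<bullet> v > 0) \<and>
     (\<forall>x. filterlim (\<lambda>p. H (x, p) / norm p) at_top at_infinity)"

definition conf_field ::
  "((real ^ 'n) \<times> (real ^ 'n) \<Rightarrow> real) \<Rightarrow> real \<Rightarrow>
   (real ^ 'n) \<times> (real ^ 'n) \<Rightarrow> (real ^ 'n) \<times> (real ^ 'n)" where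
  "conf_field H lam z = (H_p H z, - H_x H z - lam *\<^sub>R snd z)"

definition flow_orbit ::
  "((real ^ 'n) \<times> (real ^ 'n) \<Rightarrow> real) \<Rightarrow> real \<Rightarrow> real \<Rightarrow>
   (real ^ 'n) \<times> (real ^ 'n) \<Rightarrow> (real \<Rightarrow> (real ^ 'n) \<times> (real ^ 'n)) \<Rightarrow> bool" where
  "flow_orbit H lam t z \<gamma> \<longleftrightarrow>
     \<gamma> 0 = z \<and>
     (\<forall>s\<in>closed_segment 0 t.
        (\<gamma> has_vector_derivative conf_field H lam (\<gamma> s)) (at s within closed_segment 0 t))"

definition flow_defined ::
  "((real ^ 'n) \<times> (real ^ 'n) \<Rightarrow> real) \<Rightarrow> real \<Rightarrow> real \<Rightarrow> (real ^ 'n) \<times> (real ^ 'n) \<Rightarrow> bool" where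
  "flow_defined H lam t z \<longleftrightarrow> (\<exists>\<gamma>. flow_orbit H lam t z \<gamma>)"

text \<open>
  The local flow; meaningful where \<^const>\<open>flow_defined\<close> holds. For \<open>H\<close> of class \<open>C\<^sup>2\<close> the vector
  field is \<open>C\<^sup>1\<close>, so the endpoint is unique.
\<close>

definition conf_flow ::
  "((real ^ 'n) \<times> (real ^ 'n) \<Rightarrow> real) \<Rightarrow> real \<Rightarrow> real \<Rightarrow>
   (real ^ 'n) \<times> (real ^ 'n) \<Rightarrow> (real ^ 'n) \<times> (real ^ 'n)" where
  "conf_flow H lam t z = (THE w. \<exists>\<gamma>. flow_orbit H lam t z \<gamma> \<and> \<gamma> t = w)"

definition flow_invariant ::
  "((real ^ 'n) \<times> (real ^ 'n) \<Rightarrow> real) \<Rightarrow> real \<Rightarrow> ((real ^ 'n) \<times> (real ^ 'n)) set \<Rightarrow> bool" where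
  "flow_invariant H lam S \<longleftrightarrow>
     (\<forall>t. (\<forall>z\<in>S. flow_defined H lam t z) \<and> conf_flow H lam t ` S = S)"

definition graph_set :: "(real ^ 'n \<Rightarrow> real ^ 'n) \<Rightarrow> ((real ^ 'n) \<times> (real ^ 'n)) set" where
  "graph_set P = range (\<lambda>x. (x, P x))"

text \<open>The form \<open>dp \<and> dx\<close>, on tangent vectors \<open>(\<delta>x, \<delta>p)\<close>.\<close>

definition symp_form :: "(real ^ 'n) \<times> (real ^ 'n) \<Rightarrow> (real ^ 'n) \<times> (real ^ 'n) \<Rightarrow> real" where
  "symp_form a b = (\<Sum>i\<in>UNIV. snd a $ i * fst b $ i - fst a $ i * snd b $ i)"

definition graph_tangent ::
  "(real ^ 'n \<Rightarrow> real ^ 'n) \<Rightarrow> real ^ 'n \<Rightarrow> ((real ^ 'n) \<times> (real ^ 'n)) set" where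
  "graph_tangent P x = range (\<lambda>v. (v, frechet_derivative P (at x) v))"

definition lagrangian_graph :: "(real ^ 'n \<Rightarrow> real ^ 'n) \<Rightarrow> bool" where
  "lagrangian_graph P \<longleftrightarrow>
     torus_fun P \<and> C_k 1 P \<and>
     (\<forall>x. \<forall>a\<in>graph_tangent P x. \<forall>b\<in>graph_tangent P x. symp_form a b = 0)"

definition graph_decomp ::
  "(real ^ 'n \<Rightarrow> real ^ 'n) \<Rightarrow> (real ^ 'n \<Rightarrow> real) \<Rightarrow> real ^ 'n \<Rightarrow> bool" where
  "graph_decomp P u c \<longleftrightarrow> torus_fun u \<and> C_k 2 u \<and> (\<forall>x. P x = grad u x + c)"

definition exact_graph :: "(real ^ 'n \<Rightarrow> real ^ 'n) \<Rightarrow> bool" where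
  "exact_graph P \<longleftrightarrow> (\<exists>u. graph_decomp P u 0)"

end

theory Submission
  imports Defs
begin

text \<open>
  Differentiating \<open>\<Sigma> = graph P\<close> along the flow gives
  \<open>DP(x) H\<^sub>p(x, P x) = - H\<^sub>x(x, P x) - \<lambda> P x\<close>. Since \<open>\<Sigma>\<close> is Lagrangian, \<open>DP(x)\<close> is symmetric, so
  the gradient of the periodic function \<open>x \<mapsto> H(x, P x)\<close> is \<open>H\<^sub>x + DP H\<^sub>p = - \<lambda> P\<close>. Hence
  \<open>P\<close> is the gradient of \<open>- H(x, P x) / \<lambda>\<close>, and a constant vector that is a gradient of a periodic
  function vanishes.
\<close>

section \<open>Functions of class \<open>C\<^sup>k\<close>\<close>

lemma C_k_Suc_imp: "C_k (Suc k) f \<Longrightarrow> C_k k f"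
proof (induction k arbitrary: f)
  case 0
  then show ?case
    by (auto intro!: differentiable_imp_continuous_on simp: differentiable_on_def
        intro: differentiable_at_withinI)
next
  case (Suc k)
  then show ?case by (metis C_k.simps(2))
qed

lemma C_k_mono: "C_k n f \<Longrightarrow> m \<le> n \<Longrightarrow> C_k m f"
  by (induction n) (auto simp: le_Suc_eq simp del: C_k.simps dest: C_k_Suc_imp)

lemma C_1_iff:
  "C_k 1 f \<longleftrightarrow> (\<forall>x. f differentiable (at x)) \<and>
     (\<forall>v. continuous_on UNIV (\<lambda>x. frechet_derivative f (at x) v))"
  by simp

lemma C_2_iff:
  "C_k 2 f \<longleftrightarrow> (\<forall>x. f differentiable (at x)) \<and>
     (\<forall>v. C_k 1 (\<lambda>x. frechet_derivative f (at x) v))"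
  by (simp add: numeral_2_eq_2)

lemma C_1_has_derivative:
  "C_k 1 f \<Longrightarrow> (f has_derivative frechet_derivative f (at x)) (at x)"
  by (simp add: C_1_iff frechet_derivative_works)

text \<open>\<open>C_k\<close> gives continuity of the derivative one direction at a time, so
  compactness of \<open>K\<close> is applied to each of the finitely many basis directions. The sum
  of these bounds controls the operator norm, and convexity of \<open>K\<close> admits the mean
  value inequality.\<close>

lemma C_1_lipschitz_on:
  fixes f :: "'a::euclidean_space \<Rightarrow> 'b::euclidean_space"
  assumes f: "C_k 1 f" and K: "compact K" "convex K"
  shows "\<exists>L\<ge>0. \<forall>x\<in>K. \<forall>y\<in>K. norm (f x - f y) \<le> L * norm (x - y)"
proof -
  have "\<exists>B. \<forall>b\<in>Basis. \<forall>x\<in>K. norm (frechet_derivative f (at x) b) \<le> B b"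
  proof (intro bchoice ballI)
    fix b :: 'a
    have "continuous_on K (\<lambda>x. frechet_derivative f (at x) b)"
      using f by (auto simp: C_1_iff intro: continuous_on_subset)
    then have "bounded ((\<lambda>x. frechet_derivative f (at x) b) ` K)"
      using K(1) by (intro compact_imp_bounded compact_continuous_image)
    then show "\<exists>B. \<forall>x\<in>K. norm (frechet_derivative f (at x) b) \<le> B"
      by (auto simp: bounded_iff)
  qed
  then obtain B where B: "\<And>b x. b \<in> Basis \<Longrightarrow> x \<in> K \<Longrightarrow> norm (frechet_derivative f (at x) b) \<le> B b"
    by blast
  define L where "L = (\<Sum>b\<in>Basis. \<bar>B b\<bar>)"
  have "onorm (frechet_derivative f (at x)) \<le> L" if x: "x \<in> K" for x
  proof (rule onorm_bound)
    show "0 \<le> L" by (simp add: L_def sum_nonneg)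
    fix v
    interpret linear "frechet_derivative f (at x)"
      using f by (auto simp: C_1_iff intro: linear_frechet_derivative)
    have "frechet_derivative f (at x) v =
        (\<Sum>b\<in>Basis. (v \<bullet> b) *\<^sub>R frechet_derivative f (at x) b)"
      by (subst euclidean_representation[of v, symmetric]) (simp add: sum scale)
    also have "norm \<dots> \<le> (\<Sum>b\<in>Basis. \<bar>B b\<bar> * norm v)"
    proof (rule sum_norm_le)
      fix b :: 'a assume b: "b \<in> Basis"
      have "\<bar>v \<bullet> b\<bar> * norm (frechet_derivative f (at x) b) \<le> norm v * \<bar>B b\<bar>"
        using B[OF b x] Basis_le_norm[OF b, of v] by (intro mult_mono) auto
      then show "norm ((v \<bullet> b) *\<^sub>R frechet_derivative f (at x) b) \<le> \<bar>B b\<bar> * norm v"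
        by (simp add: mult.commute)
    qed
    finally show "norm (frechet_derivative f (at x) v) \<le> L * norm v"
      by (simp add: L_def sum_distrib_right)
  qed
  then have "\<forall>x\<in>K. \<forall>y\<in>K. norm (f x - f y) \<le> L * norm (x - y)"
    using K(2) C_1_has_derivative[OF f]
    by (auto intro!: differentiable_bound[of K f "\<lambda>x. frechet_derivative f (at x)"]
        intro: has_derivative_at_withinI)
  then show ?thesis
    by (intro exI[of _ L]) (simp add: L_def sum_nonneg)
qed

section \<open>Uniqueness of orbits\<close>

text \<open>Gronwall argument. The Lipschitz bound is asked for only along the two curves, so that a
  locally Lipschitz field qualifies.\<close>

lemma lipschitz_ode_unique:
  fixes \<gamma> \<delta> :: "real \<Rightarrow> 'a::real_inner"
  assumes t: "0 \<le> t"
    and \<gamma>: "\<And>s. s \<in> {0..t} \<Longrightarrow> (\<gamma> has_vector_derivative F (\<gamma> s)) (at s within {0..t})"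
    and \<delta>: "\<And>s. s \<in> {0..t} \<Longrightarrow> (\<delta> has_vector_derivative F (\<delta> s)) (at s within {0..t})"
    and L: "\<And>s. s \<in> {0..t} \<Longrightarrow> norm (F (\<gamma> s) - F (\<delta> s)) \<le> L * norm (\<gamma> s - \<delta> s)"
    and init: "\<gamma> 0 = \<delta> 0"
  shows "\<gamma> t = \<delta> t"
proof -
  \<comment> \<open>The squared distance, unlike the distance, is differentiable where the curves
    meet. Its derivative is at most \<open>2 * L\<close> times itself, and the exponential weight
    cancels exactly this growth.\<close>
  define \<phi> where "\<phi> s = exp (- (2 * L * s)) * ((\<gamma> s - \<delta> s) \<bullet> (\<gamma> s - \<delta> s))" for s
  define \<phi>' where "\<phi>' s = exp (- (2 * L * s)) *
    (2 * ((\<gamma> s - \<delta> s) \<bullet> (F (\<gamma> s) - F (\<delta> s))) - 2 * L * ((\<gamma> s - \<delta> s) \<bullet> (\<gamma> s - \<delta> s)))" for s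
  have d: "(\<phi> has_real_derivative \<phi>' s) (at s within {0..t})" if s: "s \<in> {0..t}" for s
    unfolding \<phi>_def \<phi>'_def has_field_derivative_def
    by (rule derivative_eq_intros refl \<gamma>[OF s, unfolded has_vector_derivative_def]
        \<delta>[OF s, unfolded has_vector_derivative_def] | simp)+
      (auto simp: fun_eq_iff inner_commute algebra_simps)
  have "\<phi>' s \<le> 0" if s: "s \<in> {0..t}" for s
  proof -
    have "(\<gamma> s - \<delta> s) \<bullet> (F (\<gamma> s) - F (\<delta> s)) \<le> norm (\<gamma> s - \<delta> s) * norm (F (\<gamma> s) - F (\<delta> s))"
      by (rule norm_cauchy_schwarz)
    also have "\<dots> \<le> norm (\<gamma> s - \<delta> s) * (L * norm (\<gamma> s - \<delta> s))"
      by (intro mult_left_mono L s norm_ge_zero)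
    also have "\<dots> = L * ((\<gamma> s - \<delta> s) \<bullet> (\<gamma> s - \<delta> s))"
      by (simp add: dot_square_norm power2_eq_square)
    finally show ?thesis
      by (auto simp: \<phi>'_def mult_le_0_iff)
  qed
  moreover obtain s where "s \<in> {0..t}" "\<phi> t - \<phi> 0 = \<phi>' s * (t - 0)"
    using mvt_very_simple[of 0 t \<phi> "\<lambda>s. (*) (\<phi>' s)"] t d
    by (auto simp: has_field_derivative_def)
  ultimately have "\<phi> t \<le> \<phi> 0"
    using t by (metis diff_le_0_iff_le diff_zero mult_nonpos_nonneg)
  then have "(\<gamma> t - \<delta> t) \<bullet> (\<gamma> t - \<delta> t) \<le> 0"
    by (simp add: \<phi>_def init mult_le_0_iff)
  then show ?thesis
    by (metis eq_iff_diff_eq_0 inner_gt_zero_iff not_le)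
qed

section \<open>The conformal vector field and its flow\<close>

lemma C_1_I:
  assumes "\<And>x. (f has_derivative f' x) (at x)" "\<And>v. continuous_on UNIV (\<lambda>x. f' x v)"
  shows "C_k 1 f"
proof -
  have "frechet_derivative f (at x) = f' x" for x
    using frechet_derivative_at[OF assms(1)] by simp
  then show ?thesis
    using assms by (auto simp: C_1_iff differentiable_def)
qed

section \<open>Gradients, and regularity of the vector field\<close>

lemma grad_inner:
  assumes "f differentiable (at x)"
  shows "grad f x \<bullet> v = frechet_derivative f (at x) v"
proof -
  interpret linear "frechet_derivative f (at x)"
    using assms by (rule linear_frechet_derivative)
  have "frechet_derivative f (at x) v = frechet_derivative f (at x) (\<Sum>i\<in>UNIV. v $ i *\<^sub>R axis i 1)"
    by (simp add: basis_expansion flip: scalar_mult_eq_scaleR)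
  also have "\<dots> = grad f x \<bullet> v"
    by (simp add: sum scale grad_def inner_vec_def mult.commute)
  finally show ?thesis by simp
qed

lemma grad_eqI:
  assumes "(f has_derivative (\<lambda>v. g \<bullet> v)) (at x)"
  shows "grad f x = g"
  using frechet_derivative_at[OF assms, symmetric]
  by (simp add: grad_def vec_eq_iff inner_axis)

lemma has_derivative_partial:
  assumes "H differentiable (at z)"
  shows "((\<lambda>y. H (y, snd z)) has_derivative (\<lambda>v. frechet_derivative H (at z) (v, 0))) (at (fst z))"
    and "((\<lambda>q. H (fst z, q)) has_derivative (\<lambda>v. frechet_derivative H (at z) (0, v))) (at (snd z))"
proof -
  have H: "(H has_derivative frechet_derivative H (at z)) (at (fst z, snd z))"
    using assms by (simp add: frechet_derivative_works)
  show "((\<lambda>y. H (y, snd z)) has_derivative (\<lambda>v. frechet_derivative H (at z) (v, 0))) (at (fst z))"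
    by (rule has_derivative_compose[where g = H and f = "\<lambda>y. (y, snd z)", OF _ H])
      (auto intro!: derivative_eq_intros)
  show "((\<lambda>q. H (fst z, q)) has_derivative (\<lambda>v. frechet_derivative H (at z) (0, v))) (at (snd z))"
    by (rule has_derivative_compose[where g = H and f = "\<lambda>q. (fst z, q)", OF _ H])
      (auto intro!: derivative_eq_intros)
qed

text \<open>The partial gradients represent the restrictions of the total derivative to the two
  factors. Thus their regularity can be read off from that of \<open>H\<close>.\<close>

lemma
  assumes "H differentiable (at z)"
  shows H_x_inner: "H_x H z \<bullet> v = frechet_derivative H (at z) (v, 0)"
    and H_p_inner: "H_p H z \<bullet> v = frechet_derivative H (at z) (0, v)"
  using has_derivative_partial[OF assms]
  by (simp_all add: H_x_def H_p_def grad_inner differentiableI flip: frechet_derivative_at)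

lemma C_1_vec:
  fixes f :: "'a::euclidean_space \<Rightarrow> real ^ 'm"
  assumes "\<And>i. C_k 1 (\<lambda>x. f x $ i)"
  shows "C_k 1 f"
proof (rule C_1_I)
  show "(f has_derivative (\<lambda>v. \<chi> i. frechet_derivative (\<lambda>x. f x $ i) (at x) v)) (at x)" for x
    using C_1_has_derivative[OF assms] by (auto simp: has_derivative_componentwise_within[of f] Basis_vec_def inner_axis)
  show "continuous_on UNIV (\<lambda>x. \<chi> i. frechet_derivative (\<lambda>x. f x $ i) (at x) v)" for v
    using assms by (intro continuous_on_vec_lambda) (simp add: C_1_iff)
qed

text \<open>One derivative is lost in passing from \<open>H\<close> to its field. What remains
  yields Lipschitz bounds on balls, as uniqueness of orbits requires.\<close>

lemma C_1_conf_field: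
  assumes H: "C_k 2 H"
  shows "C_k 1 (conf_field H lam)"
proof -
  have d: "H differentiable (at z)" for z
    using H unfolding C_2_iff by blast
  \<comment> \<open>Each component is a derivative of \<open>H\<close> in a fixed direction, and
    \<open>C_k 2 H\<close> says that these are of class \<open>C_k 1\<close>.\<close>
  have nth: "H_x H z $ i = frechet_derivative H (at z) (axis i 1, 0)"
    "H_p H z $ i = frechet_derivative H (at z) (0, axis i 1)" for z i
    using H_x_inner[OF d, of z "axis i 1"] H_p_inner[OF d, of z "axis i 1"]
    by (simp_all add: inner_axis)
  have X: "C_k 1 (H_x H)" and P: "C_k 1 (H_p H)"
    using H by (auto intro!: C_1_vec simp add: nth C_2_iff simp del: C_k.simps One_nat_def)
  show ?thesis
  proof (rule C_1_I)
    show "(conf_field H lam has_derivative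
        (\<lambda>v. (frechet_derivative (H_p H) (at z) v,
              - frechet_derivative (H_x H) (at z) v - lam *\<^sub>R snd v))) (at z)" for z
      unfolding conf_field_def[abs_def]
      by (intro derivative_intros has_derivative_Pair C_1_has_derivative X P)
    show "continuous_on UNIV (\<lambda>z. (frechet_derivative (H_p H) (at z) v,
              - frechet_derivative (H_x H) (at z) v - lam *\<^sub>R snd v))" for v
      using X P unfolding C_1_iff by (intro continuous_intros) blast+
  qed
qed

section \<open>Orbits and invariant sets\<close>

lemma flow_orbit_continuous_on:
  "flow_orbit H lam t z \<gamma> \<Longrightarrow> continuous_on (closed_segment 0 t) \<gamma>"
  unfolding flow_orbit_def continuous_on_eq_continuous_within
  by (blast intro: has_vector_derivative_continuous)

lemma flow_orbit_unique:
  assumes H: "C_k 2 H" and t: "0 \<le> t"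
    and \<gamma>: "flow_orbit H lam t z \<gamma>" and \<delta>: "flow_orbit H lam t z \<delta>"
  shows "\<gamma> t = \<delta> t"
proof -
  have seg: "closed_segment 0 t = {0..t}"
    using t by (simp add: closed_segment_eq_real_ivl)
  \<comment> \<open>The field need not be globally Lipschitz, but over a compact time interval both
    orbits stay in a common ball, which is compact and convex.\<close>
  have "bounded (\<gamma> ` {0..t} \<union> \<delta> ` {0..t})"
    using \<gamma>[THEN flow_orbit_continuous_on] \<delta>[THEN flow_orbit_continuous_on]
    by (auto simp: seg intro!: compact_imp_bounded compact_continuous_image)
  then obtain R where R: "\<gamma> ` {0..t} \<union> \<delta> ` {0..t} \<subseteq> cball 0 R"
    unfolding bounded_iff by (metis mem_cball_0 subsetI)
  obtain L where L: "\<And>x y. x \<in> cball 0 R \<Longrightarrow> y \<in> cball 0 R \<Longrightarrow>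
      norm (conf_field H lam x - conf_field H lam y) \<le> L * norm (x - y)"
    using C_1_lipschitz_on[OF C_1_conf_field[OF H] compact_cball convex_cball] by blast
  show ?thesis
  proof (rule lipschitz_ode_unique[OF t])
    fix s assume s: "s \<in> {0..t}"
    show "(\<gamma> has_vector_derivative conf_field H lam (\<gamma> s)) (at s within {0..t})"
      "(\<delta> has_vector_derivative conf_field H lam (\<delta> s)) (at s within {0..t})"
      using \<gamma> \<delta> s by (auto simp: flow_orbit_def seg)
    show "norm (conf_field H lam (\<gamma> s) - conf_field H lam (\<delta> s)) \<le> L * norm (\<gamma> s - \<delta> s)"
      using R s by (intro L) blast+
  qed (use \<gamma> \<delta> in \<open>simp add: flow_orbit_def\<close>)
qed

text \<open>Uniqueness of the endpoint justifies the definite description in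
  \<open>conf_flow\<close>.\<close>

lemma conf_flow_eq:
  assumes "C_k 2 H" "0 \<le> t" "flow_orbit H lam t z \<gamma>"
  shows "conf_flow H lam t z = \<gamma> t"
  unfolding conf_flow_def using assms by (blast intro: flow_orbit_unique)

lemma flow_orbit_mono:
  assumes "flow_orbit H lam t z \<gamma>" "0 \<le> s" "s \<le> t"
  shows "flow_orbit H lam s z \<gamma>"
proof -
  have "closed_segment 0 s \<subseteq> closed_segment 0 t"
    using assms by (simp add: closed_segment_eq_real_ivl)
  then show ?thesis
    using assms(1) by (auto simp: flow_orbit_def intro: has_vector_derivative_within_subset)
qed

text \<open>Invariance concerns each time-\<open>s\<close> map separately. Restricting one orbit to
  \<open>{0..s}\<close> gives an orbit for time \<open>s\<close>, so by uniqueness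
  \<open>\<gamma> s\<close> is the value of that map and lies in \<open>S\<close>.\<close>

lemma flow_invariant_orbit:
  assumes H: "C_k 2 H" and inv: "flow_invariant H lam S" and z: "z \<in> S" and t: "0 \<le> t"
  obtains \<gamma> where "flow_orbit H lam t z \<gamma>" "\<And>s. s \<in> {0..t} \<Longrightarrow> \<gamma> s \<in> S"
proof -
  obtain \<gamma> where \<gamma>: "flow_orbit H lam t z \<gamma>"
    using inv z unfolding flow_invariant_def flow_defined_def by blast
  have "\<gamma> s \<in> S" if "s \<in> {0..t}" for s
  proof -
    have "conf_flow H lam s z \<in> S"
      using inv z unfolding flow_invariant_def by blast
    then show ?thesis
      using conf_flow_eq[OF H _ flow_orbit_mono[OF \<gamma>], of s] that by simp
  qed
  with \<gamma> show thesis by (rule that)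
qed

text \<open>The field is tangent to an invariant graph: an orbit on the graph satisfies
  \<open>snd (\<gamma> s) = P (fst (\<gamma> s))\<close>, and the two sides are differentiated at
  \<open>s = 0\<close>, by the equation of motion and by the chain rule.\<close>

lemma invariant_graph_tangent:
  assumes H: "C_k 2 H" and P: "\<And>x. P differentiable (at x)"
    and inv: "flow_invariant H lam (graph_set P)"
  shows "frechet_derivative P (at x) (H_p H (x, P x)) = - H_x H (x, P x) - lam *\<^sub>R P x"
proof -
  \<comment> \<open>Any positive time would serve; only the velocity at the initial point
    matters.\<close>
  obtain \<gamma> where \<gamma>: "flow_orbit H lam 1 (x, P x) \<gamma>"
    and "\<And>s. s \<in> {0..1} \<Longrightarrow> \<gamma> s \<in> graph_set P"
    using flow_invariant_orbit[OF H inv, of "(x, P x)" 1] by (auto simp: graph_set_def)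
  then have g: "\<And>s. s \<in> {0..1} \<Longrightarrow> snd (\<gamma> s) = P (fst (\<gamma> s))"
    by (fastforce simp: graph_set_def)
  have \<gamma>0: "\<gamma> 0 = (x, P x)"
    using \<gamma> by (simp add: flow_orbit_def)
  have "(\<gamma> has_derivative (\<lambda>h. h *\<^sub>R conf_field H lam (x, P x))) (at 0 within {0..1})"
    using \<gamma> unfolding flow_orbit_def has_vector_derivative_def
    by (auto simp: closed_segment_eq_real_ivl dest!: bspec[where x = 0])
  then have fst: "((\<lambda>s. fst (\<gamma> s)) has_derivative (\<lambda>h. h *\<^sub>R H_p H (x, P x))) (at 0 within {0..1})"
    and snd: "((\<lambda>s. snd (\<gamma> s)) has_vector_derivative - H_x H (x, P x) - lam *\<^sub>R P x)
      (at 0 within {0..1})"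
    by (auto dest: has_derivative_fst has_derivative_snd
        simp: conf_field_def has_vector_derivative_def)
  have DP: "(P has_derivative frechet_derivative P (at x)) (at (fst (\<gamma> 0)))"
    using P by (simp add: \<gamma>0 frechet_derivative_works)
  have "((\<lambda>s. P (fst (\<gamma> s))) has_vector_derivative frechet_derivative P (at x) (H_p H (x, P x)))
      (at 0 within {0..1})"
    using has_derivative_compose[OF fst DP] linear_frechet_derivative[OF P]
    by (simp add: has_vector_derivative_def linear_scale)
  then have "((\<lambda>s. snd (\<gamma> s)) has_vector_derivative frechet_derivative P (at x) (H_p H (x, P x)))
      (at 0 within {0..1})"
    by (rule has_vector_derivative_transform[rotated 2]) (use g in auto)
  \<comment> \<open>A one-sided derivative at 0 is still unique, since 0 is a limit point of
    \<open>{0..1}\<close>.\<close>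
  with snd show ?thesis
    by (intro vector_derivative_unique_within) (auto simp: trivial_limit_within)
qed

section \<open>Exactness\<close>

text \<open>On the tangent vectors over \<open>v\<close> and \<open>w\<close>, the symplectic form
  is the difference of the two sides.\<close>

lemma lagrangian_graph_symmetric:
  assumes "lagrangian_graph P"
  shows "frechet_derivative P (at x) v \<bullet> w = v \<bullet> frechet_derivative P (at x) w"
proof -
  have "symp_form (v, frechet_derivative P (at x) v) (w, frechet_derivative P (at x) w) = 0"
    using assms by (auto simp: lagrangian_graph_def graph_tangent_def)
  then show ?thesis
    by (simp add: symp_form_def inner_vec_def sum_subtractf)
qed

lemma lagrangian_graph_has_derivative:
  "lagrangian_graph P \<Longrightarrow> (P has_derivative frechet_derivative P (at x)) (at x)"
  unfolding lagrangian_graph_def by (blast intro: C_1_has_derivative)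

lemma has_derivative_H_graph:
  assumes H: "C_k 2 H" and P: "lagrangian_graph P"
    and inv: "flow_invariant H lam (graph_set P)"
  shows "((\<lambda>x. H (x, P x)) has_derivative (\<lambda>v. - lam * (P x \<bullet> v))) (at x)"
proof -
  let ?DH = "frechet_derivative H (at (x, P x))" and ?DP = "frechet_derivative P (at x)"
  have d: "H differentiable (at (x, P x))"
    using H unfolding C_2_iff by blast
  note DP = lagrangian_graph_has_derivative[OF P]
  have "((\<lambda>x. H (x, P x)) has_derivative (\<lambda>v. ?DH (v, ?DP v))) (at x)"
    by (rule has_derivative_compose[where g = H])
      (use d DP in \<open>auto intro!: has_derivative_Pair simp: frechet_derivative_works\<close>)
  moreover have "?DH (v, ?DP v) = - lam * (P x \<bullet> v)" for v
  proof -
    have "?DH (v, ?DP v) = ?DH (v, 0) + ?DH (0, ?DP v)"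
      using linear_add[OF linear_frechet_derivative[OF d], of "(v, 0)" "(0, ?DP v)"] by simp
    \<comment> \<open>Symmetry moves \<open>?DP\<close> from \<open>v\<close> onto
      \<open>H_p\<close>, the one vector on which invariance determines it; the \<open>H_x\<close>
      terms then cancel.\<close>
    also have "\<dots> = H_x H (x, P x) \<bullet> v + ?DP (H_p H (x, P x)) \<bullet> v"
      by (simp add: H_x_inner[OF d] H_p_inner[OF d] lagrangian_graph_symmetric[OF P]
          flip: H_p_inner[OF d])
    also have "\<dots> = - lam * (P x \<bullet> v)"
      using invariant_graph_tangent[OF H differentiableI[OF DP] inv, of x]
      by (simp add: inner_diff_left)
    finally show ?thesis .
  qed
  ultimately show ?thesis by simp
qed

text \<open>A potential gains one derivative over its gradient: its derivative in direction
  \<open>v\<close> is \<open>P x \<bullet> v\<close>, which is of class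
  \<open>C_k 1\<close>.\<close>

lemma graph_decomp_0I:
  assumes u: "torus_fun u" and P: "C_k 1 P"
    and du: "\<And>x. (u has_derivative (\<lambda>v. P x \<bullet> v)) (at x)"
  shows "graph_decomp P u 0"
proof -
  have "frechet_derivative u (at x) = (\<lambda>v. P x \<bullet> v)" for x
    using frechet_derivative_at[OF du] by simp
  moreover have "C_k 1 (\<lambda>x. P x \<bullet> v)" for v
  proof (rule C_1_I)
    show "((\<lambda>x. P x \<bullet> v) has_derivative (\<lambda>w. frechet_derivative P (at x) w \<bullet> v)) (at x)" for x
      by (intro derivative_intros C_1_has_derivative P)
    show "continuous_on UNIV (\<lambda>x. frechet_derivative P (at x) w \<bullet> v)" for w
      using P by (intro continuous_intros) (simp add: C_1_iff)
  qed
  ultimately have "C_k 2 u"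
    using du by (auto simp add: C_2_iff differentiable_def simp del: C_k.simps One_nat_def)
  then show ?thesis
    using u grad_eqI[OF du] by (simp add: graph_decomp_def)
qed

lemma graph_decomp_has_derivative:
  assumes "graph_decomp P u c"
  shows "(u has_derivative (\<lambda>v. (P x - c) \<bullet> v)) (at x)"
proof -
  have "u differentiable (at x)" and "P x - c = grad u x"
    using assms unfolding graph_decomp_def C_2_iff by auto
  then show ?thesis
    by (simp add: grad_inner frechet_derivative_works[symmetric])
qed

text \<open>The constant vector is the cohomology class of the graph. Two decompositions make
  \<open>u x - w x + (c - d) \<bullet> x\<close> constant, and a linear function that is periodic up
  to a constant shift of this kind must vanish.\<close>

lemma graph_decomp_unique:
  assumes u: "graph_decomp P u c" and w: "graph_decomp P w d"
  shows "c = d"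
proof -
  have "((\<lambda>x. u x - w x + (c - d) \<bullet> x) has_derivative (\<lambda>_. 0)) (at x)" for x
    by (rule derivative_eq_intros graph_decomp_has_derivative[OF u]
        graph_decomp_has_derivative[OF w] refl)+
      (simp add: fun_eq_iff inner_diff_left)
  then have const: "u x - w x + (c - d) \<bullet> x = u 0 - w 0" for x
    using has_derivative_zero_unique[of UNIV "\<lambda>x. u x - w x + (c - d) \<bullet> x" x 0] by simp
  have "c $ i = d $ i" for i
  proof -
    \<comment> \<open>Along the lattice vector \<open>axis i 1\<close> the periodic part returns to
      its value at 0, which leaves \<open>(c - d) $ i = 0\<close>.\<close>
    have "int_vec (axis i 1)"
      by (simp add: int_vec_def axis_def)
    then have "u (0 + axis i 1) = u 0" "w (0 + axis i 1) = w 0"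
      using u w by (metis graph_decomp_def torus_fun_def)+
    then show ?thesis
      using const[of "axis i 1"] by (simp add: inner_axis)
  qed
  then show ?thesis by (simp add: vec_eq_iff)
qed

theorem theorem1:
  fixes H :: "(real ^ 'n) \<times> (real ^ 'n) \<Rightarrow> real"
    and P :: "real ^ 'n \<Rightarrow> real ^ 'n"
    and lam :: real and r :: nat
  assumes "lam > 0"
    and "r \<ge> 2" and "cotangent_fun H" and "C_k r H"
    and "tonelli H"
    and "lagrangian_graph P"
    and "flow_invariant H lam (graph_set P)"
  shows "(\<forall>u c. graph_decomp P u c \<longrightarrow> c = 0) \<and> exact_graph P"
proof -
  have H: "C_k 2 H"
    using assms C_k_mono by blast
  have P: "torus_fun P" "C_k 1 P"
    using \<open>lagrangian_graph P\<close> by (simp_all only: lagrangian_graph_def)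
  \<comment> \<open>\<open>H\<close> restricted to the graph has gradient
    \<open>- lam *\<^sub>R P x\<close>; dividing by \<open>- lam\<close> turns it into a potential
    for \<open>P\<close>. This is where dissipation enters: for \<open>lam = 0\<close> that gradient
    would vanish.\<close>
  define u where "u x = - H (x, P x) / lam" for x
  have "torus_fun u"
    using P(1) \<open>cotangent_fun H\<close> by (simp add: u_def torus_fun_def cotangent_fun_def)
  moreover have "(u has_derivative (\<lambda>v. P x \<bullet> v)) (at x)" for x
    unfolding u_def
    by (rule derivative_eq_intros has_derivative_H_graph[OF H assms(6,7)] refl)+
      (use \<open>lam > 0\<close> in \<open>auto simp: fun_eq_iff\<close>)
  ultimately have "graph_decomp P u 0"
    using P(2) by (intro graph_decomp_0I)
  \<comment> \<open>Any other decomposition is compared with this one, whose class is 0.\<close>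
  then show ?thesis
    using graph_decomp_unique by (auto simp: exact_graph_def)
qed

end
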